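(* Let $Q$ be a real $n\times n$ matrix with the SSVP whose rows are mutually orthogonal and all of Euclidean length $\ell$, and let $P$ be the zero-nonzero pattern of $Q$. Let $k<n$, $p\ge k$, and let $S$ be a superpattern of the $(n+k)\times(n+p)$ pattern \[\begin{bmatrix} P & O_{n,p}\\ O_{k,n} & O_{k,p}\end{bmatrix}.\] Then there exists a real matrix $A$ with pattern $S$ such that $m_A(\ell)\ge n-k$.
   Context: A pattern is a matrix with entries in $\{0,1\}$; a real matrix has pattern $S$ if its $(i,j)$ entry is nonzero exactly when $s_{ij}=1$; the zero-nonzero pattern of a matrix is obtained by replacing each nonzero entry by $1$. A superpattern of a pattern is obtained by changing some (possibly no) zeros to ones. $O_{a,b}$ is the $a\times b$ zero matrix. A real $m\times n$ matrix $A$ has the SSVP if the zero matrix is the only $m\times n$ matrix $X$ with $A^TX$ symmetric, $XA^T$ symmetric, and $A\circ X=O$ (entrywise product). For a real $p\times q$ matrix $B$, its singular values are the nonnegative square roots of the $p$ eigenvalues of $BB^T$, as a multiset, and $m_B(\sigma)$ is the multiplicity of $\sigma$ in this multiset. *)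

theory Defs
  imports
    Complex_Main
    "HOL-Computational_Algebra.Polynomial"
    "HOL-Library.Multiset"
    "Jordan_Normal_Form.Char_Poly"
begin

definition is_pattern :: "nat mat \<Rightarrow> bool" where
  "is_pattern S \<longleftrightarrow> elements_mat S \<subseteq> {0, 1}"

definition has_pattern :: "real mat \<Rightarrow> nat mat \<Rightarrow> bool" where
  "has_pattern A S \<longleftrightarrow> is_pattern S \<and> dim_row A = dim_row S \<and> dim_col A = dim_col S \<and>
     (\<forall>i < dim_row S. \<forall>j < dim_col S. A $$ (i, j) \<noteq> 0 \<longleftrightarrow> S $$ (i, j) = 1)"

definition zero_nonzero_pattern :: "real mat \<Rightarrow> nat mat" where
  "zero_nonzero_pattern A = map_mat (\<lambda>x. if x = 0 then 0 else 1) A"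

definition is_superpattern :: "nat mat \<Rightarrow> nat mat \<Rightarrow> bool" where
  "is_superpattern S R \<longleftrightarrow> is_pattern S \<and> is_pattern R \<and>
     dim_row S = dim_row R \<and> dim_col S = dim_col R \<and>
     (\<forall>i < dim_row R. \<forall>j < dim_col R. R $$ (i, j) = 1 \<longrightarrow> S $$ (i, j) = 1)"

definition hadamard_mat :: "real mat \<Rightarrow> real mat \<Rightarrow> real mat" where
  "hadamard_mat A B = mat (dim_row A) (dim_col A) (\<lambda>(i, j). A $$ (i, j) * B $$ (i, j))"

definition symmetric_mat :: "real mat \<Rightarrow> bool" where
  "symmetric_mat M \<longleftrightarrow> transpose_mat M = M"

definition SSVP :: "real mat \<Rightarrow> bool" where
  "SSVP A \<longleftrightarrow>
     (\<forall>X \<in> carrier_mat (dim_row A) (dim_col A).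
        symmetric_mat (transpose_mat A * X) \<and> symmetric_mat (X * transpose_mat A) \<and>
        hadamard_mat A X = 0\<^sub>m (dim_row A) (dim_col A)
        \<longrightarrow> X = 0\<^sub>m (dim_row A) (dim_col A))"

definition rows_mutually_orthogonal :: "real mat \<Rightarrow> bool" where
  "rows_mutually_orthogonal A \<longleftrightarrow>
     (\<forall>i < dim_row A. \<forall>j < dim_row A. i \<noteq> j \<longrightarrow> row A i \<bullet> row A j = 0)"

definition euclidean_length :: "real vec \<Rightarrow> real" where
  "euclidean_length v = sqrt (v \<bullet> v)"

definition rows_of_length :: "real mat \<Rightarrow> real \<Rightarrow> bool" where
  "rows_of_length A l \<longleftrightarrow> (\<forall>i < dim_row A. euclidean_length (row A i) = l)"

(* The symmetric matrix B * transpose_mat B has dim_row B real eigenvalues counted with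
   multiplicity, all nonnegative, and these are the real roots of its characteristic
   polynomial; so this multiset always has dim_row B elements, also if dim_row B > dim_col B. *)
definition singular_values :: "real mat \<Rightarrow> real multiset" where
  "singular_values B = image_mset sqrt (proots (char_poly (B * transpose_mat B)))"

definition sv_multiplicity :: "real mat \<Rightarrow> real \<Rightarrow> nat" where
  "sv_multiplicity B s = count (singular_values B) s"

end

theory Submission
  imports Defs
begin

text \<open>
  Split a candidate matrix as \<open>A = [M E; L D]\<close>. If the first \<open>n\<close> rows \<open>[M E]\<close> are mutually
  orthogonal of length \<open>l\<close>, then the leading \<open>n \<times> n\<close> block of \<open>A A\<^sup>T\<close> is \<open>l\<^sup>2 I\<close>, and this alone forces
  the eigenvalue \<open>l\<^sup>2\<close> to have multiplicity at least \<open>n - k\<close>, whatever the last \<open>k\<close> rows are. So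
  \<open>L\<close> and \<open>D\<close> can be chosen freely, and only \<open>M M\<^sup>T + E E\<^sup>T = l\<^sup>2 I\<close> has to be solved with \<open>E\<close> and the
  entries of \<open>M\<close> at the zeros of \<open>Q\<close> prescribed and small, and \<open>M\<close> close to \<open>Q\<close>. The derivative at
  \<open>Q\<close> of the map sending \<open>M\<close> to \<open>M M\<^sup>T\<close> and to its entries at the zeros of \<open>Q\<close> is onto precisely
  because of the SSVP; with a linear right inverse of it the equation becomes a fixed point problem
  for a contraction.
\<close>

subsection \<open>Multiplicity from a scalar block\<close>

lemma scalar_block_dvd_char_poly:
  fixes N :: "'a :: comm_ring_1 mat"
  assumes N: "N \<in> carrier_mat (n + k) (n + k)"
    and block: "\<And>i j. i < n \<Longrightarrow> j < n \<Longrightarrow> N $$ (i, j) = (if i = j then c else 0)"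
  shows "[:- c, 1:] ^ (n - k) dvd char_poly N"
proof -
  let ?C = "char_poly_matrix N"
  \<comment> \<open>In each Leibniz term at most \<open>k\<close> of the first \<open>n\<close> rows pick an entry outside the scalar block;
    every other one of them contributes a factor \<open>x - c\<close> or \<open>0\<close>.\<close>
  have dvd: "[:- c, 1:] ^ (n - k) dvd (\<Prod>i = 0..<n + k. ?C $$ (i, p i))"
    if p: "p permutes {0..<n + k}" for p
  proof -
    define J where "J = {i \<in> {0..<n}. p i < n}"
    have fin: "finite J" by (simp add: J_def)
    have "p ` ({0..<n} - J) \<subseteq> {n..<n + k}"
      using permutes_in_image[OF p] by (force simp: J_def)
    from card_mono[OF _ this] have "card (p ` ({0..<n} - J)) \<le> k" by simp
    moreover have "card (p ` ({0..<n} - J)) = card ({0..<n} - J)"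
      by (rule card_image) (rule inj_on_subset[OF permutes_inj[OF p]], simp)
    moreover have "card ({0..<n} - J) = n - card J"
      by (subst card_Diff_subset) (auto simp: J_def)
    ultimately have "n - k \<le> card J" by simp
    then have "[:- c, 1:] ^ (n - k) dvd [:- c, 1:] ^ card J"
      by (rule le_imp_power_dvd)
    also have "\<dots> = (\<Prod>i\<in>J. [:- c, 1:])" by simp
    also have "\<dots> dvd (\<Prod>i\<in>J. ?C $$ (i, p i))"
      by (rule prod_dvd_prod) (use N in \<open>auto simp: J_def char_poly_matrix_def block one_pCons\<close>)
    also have "\<dots> dvd (\<Prod>i = 0..<n + k. ?C $$ (i, p i))"
      by (rule prod_dvd_prod_subset) (auto simp: J_def)
    finally show ?thesis .
  qed
  show ?thesis
    unfolding char_poly_def det_def'[OF char_poly_matrix_closed[OF N]]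
    by (intro dvd_sum dvd_mult dvd) simp
qed

text \<open>Divisibility by the power of \<open>x - l\<^sup>2\<close> bounds the order of the root
  \<open>l\<^sup>2\<close> from below, and \<open>sqrt\<close> carries this root to
  \<open>l\<close>, since \<open>l\<close> is nonnegative.\<close>

lemma sv_multiplicity_ge_scalar_block:
  fixes A :: "real mat"
  assumes A: "A \<in> carrier_mat (n + k) m" and l: "l \<ge> 0"
    and block: "\<And>i j. i < n \<Longrightarrow> j < n \<Longrightarrow>
      (A * transpose_mat A) $$ (i, j) = (if i = j then l\<^sup>2 else 0)"
  shows "n - k \<le> sv_multiplicity A l"
proof -
  let ?N = "A * transpose_mat A"
  have N: "?N \<in> carrier_mat (n + k) (n + k)" using A by auto
  have nz: "char_poly ?N \<noteq> 0" using degree_monic_char_poly[OF N] by auto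
  have "n - k \<le> order (l\<^sup>2) (char_poly ?N)"
    using scalar_block_dvd_char_poly[OF N block] nz by (simp add: order_divides)
  also have "\<dots> = count (proots (char_poly ?N)) (l\<^sup>2)" using nz by simp
  \<comment> \<open>Passing to an image multiset never lowers a count: the copies of
    \<open>l\<^sup>2\<close> form a submultiset, and \<open>sqrt\<close> maps all of them to one
    value.\<close>
  also have "\<dots> \<le> count (image_mset sqrt (proots (char_poly ?N))) (sqrt (l\<^sup>2))"
    using image_mset_subseteq_mono[of "replicate_mset _ _" _ sqrt]
    by (metis count_le_replicate_mset_subset_eq image_replicate_mset order_refl)
  finally show ?thesis using l by (simp add: sv_multiplicity_def singular_values_def)
qed

subsection \<open>Right inverses and fixed points\<close>

text \<open>The right inverse is \<open>A\<^sup>T H\<close>, where \<open>H\<close> inverts the Gram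
  matrix \<open>A A\<^sup>T\<close>. That matrix is nonsingular: a kernel vector \<open>v\<close>
  would make the squared length of \<open>A\<^sup>T v\<close> zero.\<close>

lemma mat_right_inverse_if_trivial_left_kernel:
  fixes A :: "real mat"
  assumes A: "A \<in> carrier_mat N M"
    and ker: "\<And>v. v \<in> carrier_vec N \<Longrightarrow> transpose_mat A *\<^sub>v v = 0\<^sub>v M \<Longrightarrow> v = 0\<^sub>v N"
  shows "\<exists>B \<in> carrier_mat M N. A * B = 1\<^sub>m N"
proof -
  let ?G = "A * transpose_mat A"
  have G: "?G \<in> carrier_mat N N" using A by auto
  have "det ?G \<noteq> 0"
  proof
    assume "det ?G = 0"
    then obtain v where v: "v \<in> carrier_vec N" "v \<noteq> 0\<^sub>v N" "?G *\<^sub>v v = 0\<^sub>v N"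
      using det_0_iff_vec_prod_zero_field[OF G] by blast
    let ?w = "transpose_mat A *\<^sub>v v"
    have w: "?w \<in> carrier_vec M" using A v(1) by (intro mult_mat_vec_carrier) auto
    have "A *\<^sub>v ?w = 0\<^sub>v N" using v A assoc_mult_mat_vec[of A N M "transpose_mat A" N v] by simp
    then have "?w \<bullet> ?w = 0"
      using transpose_vec_mult_scalar[OF A w v(1)] v w A by auto
    then have "?w = 0\<^sub>v M" using conjugate_square_eq_0_vec[OF w] by simp
    with ker[OF v(1)] v(2) show False by simp
  qed
  from det_non_zero_imp_unit[OF G this, of "()"]
  obtain H where H: "H \<in> carrier_mat N N" "?G * H = 1\<^sub>m N"
    by (auto simp: Units_def ring_mat_simps)
  have "A * (transpose_mat A * H) = 1\<^sub>m N"
    using A H assoc_mult_mat[of A N M "transpose_mat A" N H N] by simp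
  then show ?thesis using A H by (intro bexI[of _ "transpose_mat A * H"]) auto
qed

text \<open>The matrix result is transported to arbitrary finite index sets by numbering them, so
  that positions of matrix entries can later serve as row and column indices.\<close>

lemma right_inverse_if_trivial_left_kernel:
  fixes m :: "'i \<Rightarrow> 'j \<Rightarrow> real"
  assumes fin: "finite I" "finite J"
    and ker: "\<And>y. \<forall>b\<in>J. (\<Sum>a\<in>I. y a * m a b) = 0 \<Longrightarrow> \<forall>a\<in>I. y a = 0"
  shows "\<exists>r. \<forall>a\<in>I. \<forall>a'\<in>I. (\<Sum>b\<in>J. m a b * r b a') = (if a = a' then 1 else 0)"
proof -
  let ?N = "card I" and ?M = "card J"
  obtain f where f: "bij_betw f {0..<?N} I" using ex_bij_betw_nat_finite[OF fin(1)] by blast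
  obtain g where g: "bij_betw g {0..<?M} J" using ex_bij_betw_nat_finite[OF fin(2)] by blast
  let ?f = "the_inv_into {0..<?N} f" and ?g = "the_inv_into {0..<?M} g"
  have f': "f (?f a) = a" "?f a < ?N" if "a \<in> I" for a
    using f that f_the_inv_into_f_bij_betw[OF f] bij_betw_apply[OF bij_betw_the_inv_into[OF f]]
    by (auto)
  have ff: "?f (f i) = i" if "i < ?N" for i
    using f that by (auto simp: bij_betw_def the_inv_into_f_f)
  have gg: "?g (g i) = i" if "i < ?M" for i
    using g that by (auto simp: bij_betw_def the_inv_into_f_f)
  define A where "A = mat ?N ?M (\<lambda>(i, j). m (f i) (g j))"
  have A: "A \<in> carrier_mat ?N ?M" by (simp add: A_def)
  have "\<exists>B \<in> carrier_mat ?M ?N. A * B = 1\<^sub>m ?N"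
  proof (rule mat_right_inverse_if_trivial_left_kernel[OF A])
    fix v assume v: "v \<in> carrier_vec ?N" and Av: "transpose_mat A *\<^sub>v v = 0\<^sub>v ?M"
    have "(\<Sum>a\<in>I. v $ ?f a * m a b) = 0" if b: "b \<in> J" for b
    proof -
      obtain j where j: "j < ?M" "b = g j" using g b by (metis atLeastLessThan_iff bij_betw_def imageE)
      have "(\<Sum>a\<in>I. v $ ?f a * m a b) = (\<Sum>i = 0..<?N. v $ ?f (f i) * m (f i) b)"
        by (rule sum.reindex_bij_betw[OF f, symmetric])
      also have "\<dots> = (transpose_mat A *\<^sub>v v) $ j"
        using v j by (auto simp: A_def scalar_prod_def ff intro!: sum.cong)
      finally show ?thesis using Av j by simp
    qed
    with ker[of "\<lambda>a. v $ ?f a"] have "\<forall>a\<in>I. v $ ?f a = 0" by blast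
    then have "v $ i = 0" if "i < ?N" for i
      using ff[OF that] bij_betw_apply[OF f, of i] that by force
    then show "v = 0\<^sub>v ?N" using v by auto
  qed
  then obtain B where B: "B \<in> carrier_mat ?M ?N" "A * B = 1\<^sub>m ?N" by blast
  have "(\<Sum>b\<in>J. m a b * B $$ (?g b, ?f a')) = (if a = a' then 1 else 0)"
    if a: "a \<in> I" "a' \<in> I" for a a'
  proof -
    have "(\<Sum>b\<in>J. m a b * B $$ (?g b, ?f a'))
        = (\<Sum>j = 0..<?M. m a (g j) * B $$ (?g (g j), ?f a'))"
      by (rule sum.reindex_bij_betw[OF g, symmetric])
    also have "\<dots> = (A * B) $$ (?f a, ?f a')"
      using f'[OF a(1)] f'[OF a(2)] B(1)
      by (auto simp: A_def scalar_prod_def gg intro!: sum.cong)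
    also have "\<dots> = (if a = a' then 1 else 0)"
    proof -
      have "?f a = ?f a' \<longleftrightarrow> a = a'" using f'(1) a by metis
      then show ?thesis unfolding B(2) using f'(2) a by simp
    qed
    finally show ?thesis .
  qed
  then show ?thesis by (intro exI[of _ "\<lambda>b a'. B $$ (?g b, ?f a')"]) blast
qed

text \<open>Banach iteration from zero with contraction factor 1/2, in the supremum distance over
  \<open>I\<close>. The first step has size at most \<open>r / 2\<close>, so the iterates never
  leave the ball of radius \<open>r\<close>.\<close>

lemma contraction_fixed_point:
  fixes F :: "('i \<Rightarrow> real) \<Rightarrow> 'i \<Rightarrow> real"
  assumes r: "r \<ge> 0"
    and start: "\<And>i. i \<in> I \<Longrightarrow> \<bar>F (\<lambda>_. 0) i\<bar> \<le> r / 2"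
    and contr: "\<And>x y d i. \<lbrakk>\<forall>j\<in>I. \<bar>x j\<bar> \<le> r; \<forall>j\<in>I. \<bar>y j\<bar> \<le> r; \<forall>j\<in>I. \<bar>x j - y j\<bar> \<le> d; i \<in> I\<rbrakk>
      \<Longrightarrow> \<bar>F x i - F y i\<bar> \<le> d / 2"
  shows "\<exists>x. (\<forall>i\<in>I. \<bar>x i\<bar> \<le> r) \<and> (\<forall>i\<in>I. F x i = x i)"
proof -
  define X where "X m = (F ^^ m) (\<lambda>_. 0)" for m
  have X0: "X 0 i = 0" and XS: "X (Suc m) = F (X m)" for m i by (simp_all add: X_def)
  \<comment> \<open>Both bounds go through one induction: \<open>r - r / 2 ^ m\<close> is the sum of
    the first \<open>m\<close> step bounds, and staying in the ball is what permits the next use of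
    \<open>contr\<close>.\<close>
  have step: "(\<forall>i\<in>I. \<bar>X m i\<bar> \<le> r - r / 2 ^ m) \<and> (\<forall>i\<in>I. \<bar>X (Suc m) i - X m i\<bar> \<le> r / 2 ^ Suc m)" for m
  proof (induction m)
    case 0
    then show ?case using start by (simp add: X_def)
  next
    case (Suc m)
    have b: "\<bar>X (Suc m) i\<bar> \<le> r - r / 2 ^ Suc m" if "i \<in> I" for i
    proof -
      have "\<bar>X m i\<bar> \<le> r - r / 2 ^ m" "\<bar>X (Suc m) i - X m i\<bar> \<le> r / 2 ^ Suc m"
        using Suc that by auto
      moreover have "r / 2 ^ m = 2 * (r / 2 ^ Suc m)" by simp
      ultimately show ?thesis by linarith
    qed
    have p: "r / 2 ^ m \<ge> 0" for m using r by simp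
    have "\<bar>F (X (Suc m)) i - F (X m) i\<bar> \<le> (r / 2 ^ Suc m) / 2" if "i \<in> I" for i
    proof (rule contr[OF _ _ _ that])
      show "\<forall>j\<in>I. \<bar>X (Suc m) j\<bar> \<le> r" using b p[of "Suc m"] by (smt (verit))
      show "\<forall>j\<in>I. \<bar>X m j\<bar> \<le> r" using Suc p[of m] by (smt (verit))
      show "\<forall>j\<in>I. \<bar>X (Suc m) j - X m j\<bar> \<le> r / 2 ^ Suc m" using Suc by blast
    qed
    then show ?case using b by (simp add: XS mult.commute)
  qed
  have bound: "\<bar>X m i\<bar> \<le> r" if "i \<in> I" for m i
  proof -
    have "r / 2 ^ m \<ge> 0" using r by simp
    then show ?thesis using step[of m] that by force
  qed
  \<comment> \<open>The limit is the telescoping series of the steps, dominated by a geometric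
    series.\<close>
  have lim: "(\<lambda>m. X m i) \<longlonglongrightarrow> (\<Sum>m. X (Suc m) i - X m i)" if i: "i \<in> I" for i
  proof -
    have "summable (\<lambda>m. X (Suc m) i - X m i)"
    proof (rule summable_comparison_test'[where g = "\<lambda>m. (r / 2) * (1 / 2) ^ m" and N = 0])
      show "summable (\<lambda>m. (r / 2) * (1 / 2) ^ m)" by (intro summable_mult summable_geometric) simp
      show "norm (X (Suc m) i - X m i) \<le> (r / 2) * (1 / 2) ^ m" for m
        using step[of m] i by (simp add: power_divide)
    qed
    then have "(\<lambda>m. \<Sum>q<m. X (Suc q) i - X q i) \<longlonglongrightarrow> (\<Sum>m. X (Suc m) i - X m i)"
      by (rule summable_LIMSEQ)
    then show ?thesis by (simp add: sum_lessThan_telescope[where f = "\<lambda>m. X m i"] X0)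
  qed
  define x where "x i = (\<Sum>m. X (Suc m) i - X m i)" for i
  have lim: "(\<lambda>m. X m i) \<longlonglongrightarrow> x i" if "i \<in> I" for i using lim[OF that] by (simp add: x_def)
  have xb: "\<bar>x i\<bar> \<le> r" if i: "i \<in> I" for i
    by (rule LIMSEQ_le_const2[OF tendsto_rabs[OF lim[OF i]]]) (use bound[OF i] in auto)
  \<comment> \<open>Pointwise convergence would not do: \<open>contr\<close> asks for one distance
    \<open>d\<close> valid on all of \<open>I\<close>, hence a rate that does not depend on
    \<open>i\<close>.\<close>
  have dist: "\<bar>x i - X m i\<bar> \<le> r / 2 ^ m" if i: "i \<in> I" for i m
  proof -
    have close: "\<bar>X (m + q) i - X m i\<bar> \<le> r / 2 ^ m - r / 2 ^ (m + q)" for q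
    proof (induction q)
      case (Suc q)
      have "\<bar>X (Suc (m + q)) i - X (m + q) i\<bar> \<le> r / 2 ^ Suc (m + q)" using step i by blast
      moreover have "r / 2 ^ (m + q) = 2 * (r / 2 ^ Suc (m + q))" by simp
      ultimately show ?case using Suc.IH unfolding add_Suc_right by linarith
    qed simp
    have "(\<lambda>q. X (q + m) i) \<longlonglongrightarrow> x i" by (rule LIMSEQ_ignore_initial_segment[OF lim[OF i]])
    then have "(\<lambda>q. \<bar>X (m + q) i - X m i\<bar>) \<longlonglongrightarrow> \<bar>x i - X m i\<bar>"
      by (intro tendsto_intros) (simp add: add.commute)
    moreover have "\<bar>X (m + q) i - X m i\<bar> \<le> r / 2 ^ m" for q
    proof -
      have "r / 2 ^ (m + q) \<ge> 0" using r by simp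
      then show ?thesis using close[of q] by linarith
    qed
    ultimately show ?thesis by (auto intro: LIMSEQ_le_const2)
  qed
  have "F x i = x i" if i: "i \<in> I" for i
  proof -
    have "(\<lambda>m. X (Suc m) i) \<longlonglongrightarrow> F x i"
    proof (rule LIM_zero_cancel, rule tendsto_0_le)
      show "\<forall>\<^sub>F m in sequentially. norm (X (Suc m) i - F x i) \<le> norm (r / 2 * (1 / 2) ^ m) * 1"
      proof (rule always_eventually, rule allI)
        fix m
        have "\<bar>F x i - F (X m) i\<bar> \<le> (r / 2 ^ m) / 2"
          by (rule contr[OF _ _ _ i]) (use xb bound dist in auto)
        then show "norm (X (Suc m) i - F x i) \<le> norm (r / 2 * (1 / 2) ^ m) * 1"
          using r by (simp add: XS power_divide abs_minus_commute mult.commute)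
      qed
      show "(\<lambda>m. r / 2 * (1 / 2) ^ m) \<longlonglongrightarrow> 0"
        by (intro tendsto_mult_right_zero LIMSEQ_power_zero) simp
    qed
    with LIMSEQ_Suc[OF lim[OF i]] show ?thesis by (metis LIMSEQ_unique)
  qed
  with xb show ?thesis by blast
qed

subsection \<open>The SSVP for multiples of orthogonal matrices\<close>

lemma gram_of_orthogonal_rows:
  assumes Q: "Q \<in> carrier_mat n m" and "rows_mutually_orthogonal Q" "rows_of_length Q l"
  shows "Q * transpose_mat Q = l\<^sup>2 \<cdot>\<^sub>m 1\<^sub>m n"
proof (rule eq_matI)
  fix i j assume "i < dim_row (l\<^sup>2 \<cdot>\<^sub>m 1\<^sub>m n)" "j < dim_col (l\<^sup>2 \<cdot>\<^sub>m 1\<^sub>m n)"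
  then have ij: "i < n" "j < n" by auto
  have "row Q i \<bullet> row Q i \<ge> 0" by (simp add: scalar_prod_def sum_nonneg)
  moreover have "sqrt (row Q i \<bullet> row Q i) = l"
    using assms ij by (auto simp: rows_of_length_def euclidean_length_def)
  ultimately have "row Q i \<bullet> row Q i = l\<^sup>2" by auto
  moreover have "row Q i \<bullet> row Q j = 0" if "i \<noteq> j"
    using assms ij that by (auto simp: rows_mutually_orthogonal_def)
  ultimately show "(Q * transpose_mat Q) $$ (i, j) = (l\<^sup>2 \<cdot>\<^sub>m 1\<^sub>m n) $$ (i, j)"
    using Q ij by auto
qed (use Q in auto)

text \<open>The zero matrix violates the SSVP, with the all-ones matrix as witness, so some row of
  \<open>Q\<close> is nonzero, and its length is the common length \<open>l\<close>.\<close>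

lemma SSVP_imp_row_length_pos:
  assumes Q: "Q \<in> carrier_mat n n" and n: "n > 0" and ssvp: "SSVP Q" and len: "rows_of_length Q l"
  shows "l > 0"
proof -
  have "Q \<noteq> 0\<^sub>m n n"
  proof
    assume Q0: "Q = 0\<^sub>m n n"
    define X :: "real mat" where "X = mat n n (\<lambda>_. 1)"
    have X: "X \<in> carrier_mat n n" by (simp add: X_def)
    have "symmetric_mat (transpose_mat Q * X)" "symmetric_mat (X * transpose_mat Q)"
      using X by (simp_all add: Q0 symmetric_mat_def)
    moreover have "hadamard_mat Q X = 0\<^sub>m n n"
      by (rule eq_matI) (auto simp: hadamard_mat_def Q0)
    ultimately have "X = 0\<^sub>m n n" using ssvp X Q by (auto simp: SSVP_def)
    then have "X $$ (0, 0) = 0" using n by simp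
    then show False using n by (simp add: X_def)
  qed
  then obtain i j where ij: "i < n" "j < n" "Q $$ (i, j) \<noteq> 0"
    using Q by (metis carrier_matD eq_matI index_zero_mat)
  have "row Q i \<noteq> 0\<^sub>v n" using ij Q by (metis carrier_matD index_row(1) index_zero_vec(1))
  then have "row Q i \<bullet> row Q i > 0"
    using Q conjugate_square_greater_0_vec[of "row Q i" n] by (auto simp: row_def)
  then show ?thesis using len ij Q by (auto simp: rows_of_length_def euclidean_length_def)
qed

text \<open>A one-sided inverse of a square matrix is two-sided; this is applied to \<open>Q\<close>
  and \<open>Q\<^sup>T\<close> divided by \<open>c\<close>.\<close>

lemma transpose_gram_of_scaled_orthogonal:
  fixes Q :: "real mat"
  assumes Q: "Q \<in> carrier_mat n n" and QQ: "Q * transpose_mat Q = c \<cdot>\<^sub>m 1\<^sub>m n" and c: "c \<noteq> 0"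
  shows "transpose_mat Q * Q = c \<cdot>\<^sub>m 1\<^sub>m n"
proof -
  let ?P = "(1 / c) \<cdot>\<^sub>m transpose_mat Q"
  have P: "?P \<in> carrier_mat n n" using Q by auto
  have "Q * ?P = (1 / c) \<cdot>\<^sub>m (c \<cdot>\<^sub>m 1\<^sub>m n)"
    using mult_smult_distrib[OF Q, of "transpose_mat Q" n "1 / c"] Q QQ by simp
  also have "\<dots> = 1\<^sub>m n" using c by (intro eq_matI) auto
  finally have PQ: "?P * Q = 1\<^sub>m n" by (rule mat_mult_left_right_inverse[OF Q P])
  have "transpose_mat Q * Q = c \<cdot>\<^sub>m ((1 / c) \<cdot>\<^sub>m (transpose_mat Q * Q))"
    using c Q by (intro eq_matI) auto
  also have "(1 / c) \<cdot>\<^sub>m (transpose_mat Q * Q) = ?P * Q"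
    using mult_smult_assoc_mat[of "transpose_mat Q" n n Q n "1 / c"] Q by simp
  finally show ?thesis unfolding PQ .
qed

text \<open>Since \<open>Q\<^sup>T (Y Q\<^sup>T) Q\<close> equals \<open>c\<close> times
  \<open>Q\<^sup>T Y\<close>, symmetry of \<open>Y Q\<^sup>T\<close> passes to
  \<open>Q\<^sup>T Y\<close>. Thus both symmetry conditions of the SSVP are met.\<close>

lemma SSVP_scaled_orthogonal:
  assumes Q: "Q \<in> carrier_mat n n" and QQ: "Q * transpose_mat Q = c \<cdot>\<^sub>m 1\<^sub>m n" and c: "c \<noteq> 0"
    and ssvp: "SSVP Q" and Y: "Y \<in> carrier_mat n n"
    and had: "\<And>i j. i < n \<Longrightarrow> j < n \<Longrightarrow> Q $$ (i, j) * Y $$ (i, j) = 0"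
    and sym: "\<And>i j. i < n \<Longrightarrow> j < n \<Longrightarrow>
      (Y * transpose_mat Q) $$ (i, j) = (Y * transpose_mat Q) $$ (j, i)"
  shows "Y = 0\<^sub>m n n"
proof -
  let ?Q' = "transpose_mat Q" and ?Y' = "transpose_mat Y"
  have Q': "?Q' \<in> carrier_mat n n" and Y': "?Y' \<in> carrier_mat n n" using Q Y by auto
  have s: "transpose_mat (Y * ?Q') = Y * ?Q'"
    by (rule eq_matI) (use Q Y sym in auto)
  then have YQ: "Y * ?Q' = Q * ?Y'" using transpose_mult[OF Y Q'] by simp
  have Q'Q: "?Q' * Q = c \<cdot>\<^sub>m 1\<^sub>m n" by (rule transpose_gram_of_scaled_orthogonal[OF Q QQ c])
  \<comment> \<open>Writing \<open>c I\<close> as \<open>Q\<^sup>T Q\<close> on the right exposes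
    the factor \<open>Y Q\<^sup>T\<close>, which is exchanged for
    \<open>Q Y\<^sup>T\<close>.\<close>
  have "c \<cdot>\<^sub>m (?Q' * Y) = (?Q' * Y) * (?Q' * Q)"
    unfolding Q'Q using mult_smult_distrib[of "?Q' * Y" n n "1\<^sub>m n" n c] Q' Y
    by (simp add: right_mult_one_mat[of _ n n])
  also have "\<dots> = ?Q' * (Y * ?Q') * Q"
    using Q Q' Y by (simp add: assoc_mult_mat[of _ n n _ n _ n])
  also have "\<dots> = (?Q' * Q) * (?Y' * Q)"
    unfolding YQ using Q Q' Y' by (simp add: assoc_mult_mat[of _ n n _ n _ n])
  also have "\<dots> = c \<cdot>\<^sub>m (?Y' * Q)"
    unfolding Q'Q using mult_smult_assoc_mat[of "1\<^sub>m n" n n "?Y' * Q" n c] Q Y'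
    by (simp add: left_mult_one_mat[of _ n n])
  finally have e: "c \<cdot>\<^sub>m (?Q' * Y) = c \<cdot>\<^sub>m (?Y' * Q)" .
  have "?Q' * Y = ?Y' * Q"
  proof (rule eq_matI)
    fix i j assume ij: "i < dim_row (?Y' * Q)" "j < dim_col (?Y' * Q)"
    have "(c \<cdot>\<^sub>m (?Q' * Y)) $$ (i, j) = (c \<cdot>\<^sub>m (?Y' * Q)) $$ (i, j)" by (simp add: e)
    then show "(?Q' * Y) $$ (i, j) = (?Y' * Q) $$ (i, j)"
      using ij c Q Y by (simp del: index_mult_mat(1))
  qed (use Q Y in auto)
  then have "symmetric_mat (?Q' * Y)"
    using transpose_mult[OF Q' Y] by (simp add: symmetric_mat_def)
  moreover have "symmetric_mat (Y * ?Q')" using s by (simp add: symmetric_mat_def)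
  moreover have "hadamard_mat Q Y = 0\<^sub>m n n"
    by (rule eq_matI) (use Q had in \<open>auto simp: hadamard_mat_def\<close>)
  ultimately show ?thesis using ssvp Q Y by (auto simp: SSVP_def)
qed

text \<open>The map from skew-symmetric \<open>K\<close> to the entries of \<open>K Q\<close> on
  \<open>Z\<close> is onto. By duality, a functional \<open>Y\<close> supported on \<open>Z\<close>
  that kills the image has \<open>Y Q\<^sup>T\<close> orthogonal to all skew-symmetric matrices, so
  \<open>Y Q\<^sup>T\<close> is symmetric and \<open>Y\<close> vanishes by the SSVP. The column
  \<open>r _ z\<close> yields, after subtracting its transpose, a preimage of the unit vector at
  \<open>z\<close>.\<close>

lemma SSVP_skew_right_inverse:
  fixes Q :: "real mat"
  defines "Z \<equiv> {z \<in> {0..<dim_row Q} \<times> {0..<dim_row Q}. Q $$ z = 0}"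
  assumes Q: "Q \<in> carrier_mat n n" and QQ: "Q * transpose_mat Q = c \<cdot>\<^sub>m 1\<^sub>m n" and c: "c \<noteq> 0"
    and ssvp: "SSVP Q"
  shows "\<exists>r :: nat \<times> nat \<Rightarrow> nat \<times> nat \<Rightarrow> real. \<forall>(i, j)\<in>Z. \<forall>z\<in>Z.
    (\<Sum>a = 0..<n. (r (i, a) z - r (a, i) z) * Q $$ (a, j)) = (if (i, j) = z then 1 else 0)"
proof -
  let ?I = "{0..<n}"
  have Z: "Z = {z \<in> ?I \<times> ?I. Q $$ z = 0}" using Q by (simp add: Z_def)
  \<comment> \<open>\<open>m z (a, b)\<close> is the entry at \<open>z\<close> of \<open>(E - E\<^sup>T) Q\<close>, where \<open>E\<close> is the matrix unit at \<open>(a, b)\<close>.\<close>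
  define m where "m z b = (if fst b = fst z then Q $$ (snd b, snd z) else 0)
    - (if snd b = fst z then Q $$ (fst b, snd z) else 0)" for z b :: "nat \<times> nat"
  have fin: "finite Z" "finite (?I \<times> ?I)" by (simp_all add: Z)
  have "\<exists>r. \<forall>a\<in>Z. \<forall>a'\<in>Z. (\<Sum>b\<in>?I \<times> ?I. m a b * r b a') = (if a = a' then 1 else 0)"
  proof (rule right_inverse_if_trivial_left_kernel[OF fin])
    fix y assume y: "\<forall>b\<in>?I \<times> ?I. (\<Sum>z\<in>Z. y z * m z b) = 0"
    \<comment> \<open>Extension by zero off the zeros of \<open>Q\<close> makes the entrywise
      product of \<open>Q\<close> and \<open>Y\<close> vanish.\<close>
    define Y where "Y = mat n n (\<lambda>z. if z \<in> Z then y z else 0)"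
    have Y: "Y \<in> carrier_mat n n" by (simp add: Y_def)
    have "(Y * transpose_mat Q) $$ (a, b) = (Y * transpose_mat Q) $$ (b, a)"
      if ab: "a < n" "b < n" for a b
    proof -
      have "0 = (\<Sum>z\<in>Z. y z * m z (a, b))" using y ab by simp
      also have "\<dots> = (\<Sum>z\<in>?I \<times> ?I. Y $$ z * m z (a, b))"
        by (rule sum.mono_neutral_cong_left) (auto simp: Z Y_def split: if_splits)
      also have "\<dots> = (\<Sum>i\<in>?I. \<Sum>j\<in>?I. Y $$ (i, j) * m (i, j) (a, b))"
        unfolding sum.cartesian_product by (simp add: case_prod_unfold)
      also have "\<dots> = (\<Sum>j\<in>?I. \<Sum>i\<in>?I. Y $$ (i, j) * m (i, j) (a, b))"
        by (rule sum.swap)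
      also have "\<dots> = (\<Sum>j\<in>?I. (\<Sum>i\<in>?I. if a = i then Y $$ (i, j) * Q $$ (b, j) else 0)
          - (\<Sum>i\<in>?I. if b = i then Y $$ (i, j) * Q $$ (a, j) else 0))"
        unfolding sum_subtractf[symmetric]
        by (intro sum.cong refl) (auto simp: m_def right_diff_distrib)
      also have "\<dots> = (\<Sum>j\<in>?I. Y $$ (a, j) * Q $$ (b, j)) - (\<Sum>j\<in>?I. Y $$ (b, j) * Q $$ (a, j))"
        using ab by (simp add: sum_subtractf)
      also have "\<dots> = (Y * transpose_mat Q) $$ (a, b) - (Y * transpose_mat Q) $$ (b, a)"
        using ab Q Y by (simp add: scalar_prod_def)
      finally show ?thesis by simp
    qed
    then have "Y = 0\<^sub>m n n"
      by (intro SSVP_scaled_orthogonal[OF Q QQ c ssvp Y]) (auto simp: Y_def Z)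
    then have "Y $$ z = 0" if "z \<in> Z" for z using that by (auto simp: Z)
    then show "\<forall>z\<in>Z. y z = 0" by (auto simp: Y_def Z)
  qed
  then obtain r where r: "\<And>a a'. a \<in> Z \<Longrightarrow> a' \<in> Z \<Longrightarrow>
      (\<Sum>b\<in>?I \<times> ?I. m a b * r b a') = (if a = a' then 1 else 0)" by blast
  have "(\<Sum>a\<in>?I. (r (i, a) z - r (a, i) z) * Q $$ (a, j)) = (if (i, j) = z then 1 else 0)"
    if ij: "(i, j) \<in> Z" and z: "z \<in> Z" for i j z
  proof -
    have i: "i < n" using ij by (simp add: Z)
    have "(if (i, j) = z then 1 else 0) = (\<Sum>b\<in>?I \<times> ?I. m (i, j) b * r b z)"
      using r[OF ij z] by simp
    also have "\<dots> = (\<Sum>a\<in>?I. \<Sum>b\<in>?I. m (i, j) (a, b) * r (a, b) z)"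
      unfolding sum.cartesian_product by (simp add: case_prod_unfold)
    also have "\<dots> = (\<Sum>a\<in>?I. \<Sum>b\<in>?I. if a = i then Q $$ (b, j) * r (a, b) z else 0)
        - (\<Sum>a\<in>?I. \<Sum>b\<in>?I. if b = i then Q $$ (a, j) * r (a, b) z else 0)"
      unfolding sum_subtractf[symmetric]
      by (intro sum.cong refl) (auto simp: m_def left_diff_distrib)
    also have "(\<Sum>a\<in>?I. \<Sum>b\<in>?I. if a = i then Q $$ (b, j) * r (a, b) z else 0)
        = (\<Sum>b\<in>?I. Q $$ (b, j) * r (i, b) z)"
      by (subst sum.swap) (use i in simp)
    also have "(\<Sum>a\<in>?I. \<Sum>b\<in>?I. if b = i then Q $$ (a, j) * r (a, b) z else 0)
        = (\<Sum>a\<in>?I. Q $$ (a, j) * r (a, i) z)"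
      using i by simp
    finally show ?thesis by (simp add: sum_subtractf algebra_simps)
  qed
  then show ?thesis by (intro exI[of _ r]) blast
qed

section \<open>Right inverse of the linearized problem, with entrywise bounds\<close>

lemma mult_mat_entry_diff_le:
  fixes A A' B :: "real mat"
  assumes "A \<in> carrier_mat k n" "A' \<in> carrier_mat k n" "B \<in> carrier_mat n m"
    and A: "\<And>i j. i < k \<Longrightarrow> j < n \<Longrightarrow> \<bar>A $$ (i, j) - A' $$ (i, j)\<bar> \<le> d"
    and B: "\<And>i j. i < n \<Longrightarrow> j < m \<Longrightarrow> \<bar>B $$ (i, j)\<bar> \<le> q"
    and ij: "i < k" "j < m"
  shows "\<bar>(A * B) $$ (i, j) - (A' * B) $$ (i, j)\<bar> \<le> real n * (d * q)"
proof -
  have "(A * B) $$ (i, j) - (A' * B) $$ (i, j)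
      = (\<Sum>a = 0..<n. (A $$ (i, a) - A' $$ (i, a)) * B $$ (a, j))"
    using assms(1-3) ij by (simp add: scalar_prod_def left_diff_distrib sum_subtractf)
  also have "\<bar>\<dots>\<bar> \<le> (\<Sum>a = 0..<n. \<bar>(A $$ (i, a) - A' $$ (i, a)) * B $$ (a, j)\<bar>)"
    by (rule sum_abs)
  also have "\<dots> \<le> (\<Sum>a = 0..<n. d * q)"
  proof (rule sum_mono)
    fix a assume "a \<in> {0..<n}"
    then have a: "a < n" by simp
    have "0 \<le> d" using A[OF ij(1) a] by linarith
    then show "\<bar>(A $$ (i, a) - A' $$ (i, a)) * B $$ (a, j)\<bar> \<le> d * q"
      unfolding abs_mult by (intro mult_mono A[OF ij(1) a] B[OF a ij(2)]) simp_all
  qed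
  finally show ?thesis by simp
qed

text \<open>The derivative of \<open>M M\<^sup>T\<close> at \<open>Q\<close> in direction
  \<open>X\<close> is \<open>Q X\<^sup>T + X Q\<^sup>T\<close>; \<open>R W T\<close> is a direction
  where it equals \<open>W\<close> and where the entries at the zeros of \<open>Q\<close> are those
  of \<open>T\<close>. The value at zero and the Lipschitz bound are recorded for the later
  contraction argument.\<close>

lemma SSVP_linearization_right_inverse:
  fixes Q :: "real mat"
  assumes Q: "Q \<in> carrier_mat n n" and QQ: "Q * transpose_mat Q = c \<cdot>\<^sub>m 1\<^sub>m n" and c: "c \<noteq> 0"
    and ssvp: "SSVP Q"
  obtains R :: "real mat \<Rightarrow> real mat \<Rightarrow> real mat" and C :: real where
    "C \<ge> 0" and "R (0\<^sub>m n n) (0\<^sub>m n n) = 0\<^sub>m n n"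
    and "\<And>W T. W \<in> carrier_mat n n \<Longrightarrow> R W T \<in> carrier_mat n n"
    and "\<And>W T. W \<in> carrier_mat n n \<Longrightarrow> transpose_mat W = W \<Longrightarrow>
      Q * transpose_mat (R W T) + R W T * transpose_mat Q = W"
    and "\<And>W T i j. W \<in> carrier_mat n n \<Longrightarrow> i < n \<Longrightarrow> j < n \<Longrightarrow> Q $$ (i, j) = 0 \<Longrightarrow>
      R W T $$ (i, j) = T $$ (i, j)"
    and "\<And>W W' T T' d i j. \<lbrakk>W \<in> carrier_mat n n; W' \<in> carrier_mat n n;
      \<And>i j. i < n \<Longrightarrow> j < n \<Longrightarrow> \<bar>W $$ (i, j) - W' $$ (i, j)\<bar> \<le> d;
      \<And>i j. i < n \<Longrightarrow> j < n \<Longrightarrow> \<bar>T $$ (i, j) - T' $$ (i, j)\<bar> \<le> d; i < n; j < n\<rbrakk>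
      \<Longrightarrow> \<bar>R W T $$ (i, j) - R W' T' $$ (i, j)\<bar> \<le> C * d"
proof -
  let ?I = "{0..<n}"
  define Z where "Z = {z \<in> ?I \<times> ?I. Q $$ z = 0}"
  have finZ: "finite Z" by (simp add: Z_def)
  obtain r :: "nat \<times> nat \<Rightarrow> nat \<times> nat \<Rightarrow> real" where r: "\<And>i j z. (i, j) \<in> Z \<Longrightarrow> z \<in> Z \<Longrightarrow>
      (\<Sum>a = 0..<n. (r (i, a) z - r (a, i) z) * Q $$ (a, j)) = (if (i, j) = z then 1 else 0)"
    using SSVP_skew_right_inverse[OF Q QQ c ssvp] Q unfolding Z_def by fastforce
  \<comment> \<open>Without the entry condition \<open>U W\<close> solves the linear equation; adding \<open>K Q\<close> with \<open>K\<close> skew-symmetric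
    keeps it a solution and corrects the entries at the zeros of \<open>Q\<close>.\<close>
  define U where "U W = (1 / (2 * c)) \<cdot>\<^sub>m (W * Q)" for W
  define K where "K W T = mat n n (\<lambda>(i, a). \<Sum>z\<in>Z. (T $$ z - U W $$ z) * (r (i, a) z - r (a, i) z))"
    for W T
  define R where "R W T = U W + K W T * Q" for W T
  have U: "U W \<in> carrier_mat n n" if "W \<in> carrier_mat n n" for W
    using Q that by (simp add: U_def)
  have K: "K W T \<in> carrier_mat n n" for W T by (simp add: K_def)
  have Rc: "R W T \<in> carrier_mat n n" if "W \<in> carrier_mat n n" for W T
    unfolding R_def by (intro add_carrier_mat mult_carrier_mat[OF K Q])
  have skew: "K W T $$ (j, i) = - (K W T $$ (i, j))" if "i < n" "j < n" for W T i j
  proof -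
    have "K W T $$ (j, i) = (\<Sum>z\<in>Z. - ((T $$ z - U W $$ z) * (r (i, j) z - r (j, i) z)))"
      using that by (auto simp: K_def algebra_simps intro!: sum.cong)
    then show ?thesis using that by (simp add: K_def sum_negf)
  qed
  have U0: "U (0\<^sub>m n n) = 0\<^sub>m n n" using Q by (simp add: U_def)
  have R0: "R (0\<^sub>m n n) (0\<^sub>m n n) = 0\<^sub>m n n"
  proof -
    have "K (0\<^sub>m n n) (0\<^sub>m n n) = 0\<^sub>m n n"
      by (rule eq_matI) (auto simp: K_def U0 Z_def intro!: sum.neutral)
    then show ?thesis using Q by (simp add: R_def U0)
  qed
  have lin: "Q * transpose_mat (R W T) + R W T * transpose_mat Q = W"
    if W: "W \<in> carrier_mat n n" "transpose_mat W = W" for W T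
  proof -
    let ?Q' = "transpose_mat Q"
    have Q': "?Q' \<in> carrier_mat n n" using Q by simp
    have "U W * ?Q' = (1 / (2 * c)) \<cdot>\<^sub>m (W * (Q * ?Q'))"
      using W Q Q' by (simp add: U_def mult_smult_assoc_mat[of _ n n _ n] assoc_mult_mat[of _ n n _ n _ n])
    also have "\<dots> = (1 / 2) \<cdot>\<^sub>m W"
      using W c by (simp add: QQ mult_smult_distrib[of _ n n _ n] right_mult_one_mat[of _ n n])
        (intro eq_matI, auto)
    finally have UQ: "U W * ?Q' = (1 / 2) \<cdot>\<^sub>m W" .
    \<comment> \<open>The resulting term \<open>c K\<close> is skew-symmetric, so it cancels when
      \<open>R W T * Q\<^sup>T\<close> is added to its transpose; only the two halves of
      \<open>W\<close> survive.\<close>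
    have "K W T * Q * ?Q' = c \<cdot>\<^sub>m K W T"
      using K[of W T] Q Q'
      by (simp add: QQ assoc_mult_mat[of _ n n _ n _ n] mult_smult_distrib[of _ n n _ n] right_mult_one_mat[of _ n n])
    then have G: "R W T * ?Q' = (1 / 2) \<cdot>\<^sub>m W + c \<cdot>\<^sub>m K W T"
      unfolding R_def using U[OF W(1)] K[of W T] Q Q' UQ
      by (subst add_mult_distrib_mat[of _ n n _ _ n]) auto
    have G': "Q * transpose_mat (R W T) = transpose_mat (R W T * ?Q')"
      using transpose_mult[OF Rc[OF W(1)] Q'] by simp
    show ?thesis
    proof (rule eq_matI)
      fix i j assume "i < dim_row W" "j < dim_col W"
      then have ij: "i < n" "j < n" using W(1) by auto
      have "W $$ (j, i) = W $$ (i, j)"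
        using arg_cong[OF W(2), of "\<lambda>M. M $$ (i, j)"] W(1) ij by simp
      then show "(Q * transpose_mat (R W T) + R W T * ?Q') $$ (i, j) = W $$ (i, j)"
        unfolding G' unfolding G using W(1) K[of W T] ij skew[OF ij, of W T] by simp
    qed (use W(1) Q Rc[OF W(1), of T] in auto)
  qed
  have onZ: "R W T $$ (i, j) = T $$ (i, j)"
    if W: "W \<in> carrier_mat n n" and ij: "i < n" "j < n" "Q $$ (i, j) = 0" for W T i j
  proof -
    have ijZ: "(i, j) \<in> Z" using ij by (simp add: Z_def)
    let ?t = "\<lambda>z. T $$ z - U W $$ z"
    have "(K W T * Q) $$ (i, j)
        = (\<Sum>a = 0..<n. \<Sum>z\<in>Z. ?t z * ((r (i, a) z - r (a, i) z) * Q $$ (a, j)))"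
      using ij K[of W T] Q by (simp add: scalar_prod_def K_def sum_distrib_right mult.assoc)
    also have "\<dots> = (\<Sum>z\<in>Z. ?t z * (\<Sum>a = 0..<n. (r (i, a) z - r (a, i) z) * Q $$ (a, j)))"
      by (subst sum.swap) (simp add: sum_distrib_left)
    also have "\<dots> = (\<Sum>z\<in>Z. ?t z * (if (i, j) = z then 1 else 0))"
      using r[OF ijZ] by (intro sum.cong) auto
    also have "\<dots> = ?t (i, j)" using finZ ijZ by (simp add: if_distrib cong: if_cong)
    finally show ?thesis using ij U[OF W] K[of W T] Q by (simp add: R_def)
  qed
  \<comment> \<open>Sums serve as crude upper bounds in place of maxima, so empty index sets need no
    separate case.\<close>
  define q where "q = (\<Sum>z\<in>?I \<times> ?I. \<bar>Q $$ z\<bar>)"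
  define D where "D = (\<Sum>b\<in>?I \<times> ?I. \<Sum>z\<in>Z. \<bar>r b z - r (snd b, fst b) z\<bar>)"
  have q: "\<bar>Q $$ (i, j)\<bar> \<le> q" if "i < n" "j < n" for i j
    unfolding q_def using that by (intro member_le_sum[of "(i, j)"]) auto
  have D: "(\<Sum>z\<in>Z. \<bar>r (i, a) z - r (a, i) z\<bar>) \<le> D" if "i < n" "a < n" for i a
    unfolding D_def using that
      member_le_sum[of "(i, a)" "?I \<times> ?I" "\<lambda>b. \<Sum>z\<in>Z. \<bar>r b z - r (snd b, fst b) z\<bar>"]
    by (auto simp: sum_nonneg)
  have q0: "q \<ge> 0" and D0: "D \<ge> 0" by (simp_all add: q_def D_def sum_nonneg)
  \<comment> \<open>\<open>B\<close> is the Lipschitz constant of \<open>U\<close>. The correction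
    data \<open>T - U W\<close> then changes by at most \<open>(1 + B) * d\<close>, and the second
    summand of \<open>C\<close> accounts for its passage through \<open>r\<close> and the product
    with \<open>Q\<close>.\<close>
  define B where "B = real n * q * \<bar>1 / (2 * c)\<bar>"
  define C where "C = B + real n * ((1 + B) * D * q)"
  have B0: "B \<ge> 0" using q0 by (simp add: B_def)
  have C0: "C \<ge> 0" using q0 B0 D0 by (simp add: C_def)
  have lip: "\<bar>R W T $$ (i, j) - R W' T' $$ (i, j)\<bar> \<le> C * d"
    if W: "W \<in> carrier_mat n n" and W': "W' \<in> carrier_mat n n"
      and dW: "\<And>i j. i < n \<Longrightarrow> j < n \<Longrightarrow> \<bar>W $$ (i, j) - W' $$ (i, j)\<bar> \<le> d"
      and dT: "\<And>i j. i < n \<Longrightarrow> j < n \<Longrightarrow> \<bar>T $$ (i, j) - T' $$ (i, j)\<bar> \<le> d"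
      and ij: "i < n" "j < n" for W W' T T' d i j
  proof -
    have d: "d \<ge> 0" using dW[OF ij] by linarith
    have dU: "\<bar>U W $$ (i, j) - U W' $$ (i, j)\<bar> \<le> B * d" if ij: "i < n" "j < n" for i j
    proof -
      have "U W $$ (i, j) - U W' $$ (i, j)
          = (1 / (2 * c)) * ((W * Q) $$ (i, j) - (W' * Q) $$ (i, j))"
        using W W' Q ij by (simp add: U_def right_diff_distrib del: index_mult_mat(1))
      also have "\<bar>\<dots>\<bar> \<le> \<bar>1 / (2 * c)\<bar> * (real n * (d * q))"
        unfolding abs_mult
        by (intro mult_left_mono mult_mat_entry_diff_le[OF W W' Q dW q ij]) auto
      finally show ?thesis by (simp add: B_def mult_ac)
    qed
    have dK: "\<bar>K W T $$ (i, a) - K W' T' $$ (i, a)\<bar> \<le> (1 + B) * d * D" if ia: "i < n" "a < n" for i a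
    proof -
      let ?s = "\<lambda>z. (T $$ z - U W $$ z) - (T' $$ z - U W' $$ z)"
      let ?r = "\<lambda>z. r (i, a) z - r (a, i) z"
      have s: "\<bar>?s z\<bar> \<le> (1 + B) * d" if "z \<in> Z" for z
      proof -
        obtain x y where z: "z = (x, y)" by (cases z)
        then have "x < n" "y < n" using that by (auto simp: Z_def)
        from dT[OF this] dU[OF this] show ?thesis unfolding z by (simp add: algebra_simps)
      qed
      have "K W T $$ (i, a) - K W' T' $$ (i, a) = (\<Sum>z\<in>Z. ?s z * ?r z)"
        using ia by (simp add: K_def left_diff_distrib sum_subtractf)
      also have "\<bar>\<dots>\<bar> \<le> (\<Sum>z\<in>Z. \<bar>?s z * ?r z\<bar>)" by (rule sum_abs)
      also have "\<dots> \<le> (\<Sum>z\<in>Z. (1 + B) * d * \<bar>?r z\<bar>)"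
        unfolding abs_mult by (intro sum_mono mult_right_mono s) auto
      also have "\<dots> = (1 + B) * d * (\<Sum>z\<in>Z. \<bar>?r z\<bar>)" by (simp add: sum_distrib_left)
      also have "\<dots> \<le> (1 + B) * d * D"
        using B0 d by (intro mult_left_mono D[OF ia]) auto
      finally show ?thesis .
    qed
    have "\<bar>(K W T * Q) $$ (i, j) - (K W' T' * Q) $$ (i, j)\<bar> \<le> real n * ((1 + B) * d * D * q)"
      by (rule mult_mat_entry_diff_le[OF K K Q dK q ij])
    moreover have "R W T $$ (i, j) - R W' T' $$ (i, j) = (U W $$ (i, j) - U W' $$ (i, j))
        + ((K W T * Q) $$ (i, j) - (K W' T' * Q) $$ (i, j))"
      using ij U[OF W] U[OF W'] K[of W T] K[of W' T'] Q
      by (simp add: R_def del: index_mult_mat(1))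
    moreover have "C * d = B * d + real n * ((1 + B) * d * D * q)"
      by (simp add: C_def algebra_simps)
    ultimately show ?thesis using dU[OF ij] by linarith
  qed
  show ?thesis by (rule that[OF C0 R0 Rc lin onZ lip]) assumption+
qed

section \<open>Solving the nonlinear Gram equation near \<open>Q\<close>\<close>

lemma gram_entry_diff_le:
  fixes H H' :: "real mat"
  assumes H: "H \<in> carrier_mat k n" "H' \<in> carrier_mat k n"
    and b: "\<And>i j. i < k \<Longrightarrow> j < n \<Longrightarrow> \<bar>H $$ (i, j)\<bar> \<le> \<rho>"
    and b': "\<And>i j. i < k \<Longrightarrow> j < n \<Longrightarrow> \<bar>H' $$ (i, j)\<bar> \<le> \<rho>"
    and d: "\<And>i j. i < k \<Longrightarrow> j < n \<Longrightarrow> \<bar>H $$ (i, j) - H' $$ (i, j)\<bar> \<le> d"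
    and ij: "i < k" "j < k"
  shows "\<bar>(H * transpose_mat H) $$ (i, j) - (H' * transpose_mat H') $$ (i, j)\<bar> \<le> real n * (2 * \<rho> * d)"
proof -
  let ?T = transpose_mat
  \<comment> \<open>The mixed product \<open>H' H\<^sup>T\<close> is compared with both Gram
    matrices. The second comparison is made at the transposed position \<open>(j, i)\<close>, so
    that again only the left factor changes.\<close>
  have "\<bar>(H * ?T H) $$ (i, j) - (H' * ?T H) $$ (i, j)\<bar> \<le> real n * (d * \<rho>)"
    by (rule mult_mat_entry_diff_le[of _ k n _ _ k]) (use assms in auto)
  moreover have "\<bar>(H * ?T H') $$ (j, i) - (H' * ?T H') $$ (j, i)\<bar> \<le> real n * (d * \<rho>)"
    by (rule mult_mat_entry_diff_le[of _ k n _ _ k]) (use assms in auto)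
  moreover have "(H * ?T H') $$ (j, i) = (H' * ?T H) $$ (i, j)"
    "(H' * ?T H') $$ (j, i) = (H' * ?T H') $$ (i, j)"
    using H ij by (auto simp: scalar_prod_def mult.commute)
  ultimately show ?thesis by (simp add: mult_ac)
qed

text \<open>With \<open>M = Q + H\<close> the equation reads
  \<open>Q H\<^sup>T + H Q\<^sup>T = W H\<close>, where \<open>W H\<close> consists of a term
  quadratic in \<open>H\<close> and one quadratic in \<open>\<epsilon>\<close>. The right inverse
  \<open>R\<close> turns it into a fixed point equation for \<open>H\<close>, contracting on a small
  ball.\<close>

lemma perturb_to_orthogonal_rows:
  fixes Q E T :: "real mat"
  assumes Q: "Q \<in> carrier_mat n n" and QQ: "Q * transpose_mat Q = c \<cdot>\<^sub>m 1\<^sub>m n" and c: "c \<noteq> 0"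
    and ssvp: "SSVP Q" and E: "E \<in> carrier_mat n p"
  shows "\<exists>\<epsilon> > 0. \<exists>M \<in> carrier_mat n n.
    M * transpose_mat M + (\<epsilon> \<cdot>\<^sub>m E) * transpose_mat (\<epsilon> \<cdot>\<^sub>m E) = c \<cdot>\<^sub>m 1\<^sub>m n \<and>
    (\<forall>i<n. \<forall>j<n. if Q $$ (i, j) = 0 then M $$ (i, j) = \<epsilon> * T $$ (i, j) else M $$ (i, j) \<noteq> 0)"
proof -
  let ?I = "{0..<n} \<times> {0..<n}"
  obtain R :: "real mat \<Rightarrow> real mat \<Rightarrow> real mat" and C :: real
    where C: "C \<ge> 0" and R0: "R (0\<^sub>m n n) (0\<^sub>m n n) = 0\<^sub>m n n"
    and Rc: "\<And>W T. W \<in> carrier_mat n n \<Longrightarrow> R W T \<in> carrier_mat n n"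
    and lin: "\<And>W T. W \<in> carrier_mat n n \<Longrightarrow> transpose_mat W = W \<Longrightarrow>
      Q * transpose_mat (R W T) + R W T * transpose_mat Q = W"
    and onZ: "\<And>W T i j. W \<in> carrier_mat n n \<Longrightarrow> i < n \<Longrightarrow> j < n \<Longrightarrow> Q $$ (i, j) = 0 \<Longrightarrow>
      R W T $$ (i, j) = T $$ (i, j)"
    and lip: "\<And>W W' T T' d i j. \<lbrakk>W \<in> carrier_mat n n; W' \<in> carrier_mat n n;
      \<And>i j. i < n \<Longrightarrow> j < n \<Longrightarrow> \<bar>W $$ (i, j) - W' $$ (i, j)\<bar> \<le> d;
      \<And>i j. i < n \<Longrightarrow> j < n \<Longrightarrow> \<bar>T $$ (i, j) - T' $$ (i, j)\<bar> \<le> d; i < n; j < n\<rbrakk>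
      \<Longrightarrow> \<bar>R W T $$ (i, j) - R W' T' $$ (i, j)\<bar> \<le> C * d"
  proof (rule SSVP_linearization_right_inverse[OF Q QQ c ssvp], goal_cases)
    case prems: (1 R C)
    show ?case by (rule prems(1)) (fact prems)+
  qed
  \<comment> \<open>A positive lower bound for the absolute values of the nonzero entries of
    \<open>Q\<close>; the inserted 1 keeps the set nonempty for \<open>Min\<close>.\<close>
  define \<mu> where "\<mu> = Min (insert 1 ((\<lambda>z. \<bar>Q $$ z\<bar>) ` {z \<in> ?I. Q $$ z \<noteq> 0}))"
  have fin: "finite (insert 1 ((\<lambda>z. \<bar>Q $$ z\<bar>) ` {z \<in> ?I. Q $$ z \<noteq> 0}))" by simp
  have \<mu>0: "\<mu> > 0" unfolding \<mu>_def by (subst Min_gr_iff) (use fin in auto)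
  have \<mu>: "\<mu> \<le> \<bar>Q $$ (i, j)\<bar>" if "i < n" "j < n" "Q $$ (i, j) \<noteq> 0" for i j
    unfolding \<mu>_def using that by (intro Min_le fin) auto
  \<comment> \<open>The first bound keeps the nonzero entries of \<open>Q\<close> nonzero after a
    change by at most \<open>\<rho>\<close>; the second makes the contraction factor
    \<open>2 * C * n * \<rho>\<close> at most 1/2.\<close>
  define \<rho> where "\<rho> = min (\<mu> / 2) (1 / (4 * (C * n + 1)))"
  have Cn: "C * n \<ge> 0" using C by simp
  have \<rho>0: "\<rho> > 0" using \<mu>0 Cn by (simp add: \<rho>_def)
  have "\<rho> * (4 * (C * n + 1)) \<le> (1 / (4 * (C * n + 1))) * (4 * (C * n + 1))"
    using Cn by (intro mult_right_mono) (auto simp: \<rho>_def)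
  also have "\<dots> = 1" using Cn by simp
  finally have \<rho>C: "4 * (C * n) * \<rho> \<le> 1" using \<rho>0 by (simp add: algebra_simps)
  define B where "B = (\<Sum>z\<in>?I. \<bar>(E * transpose_mat E) $$ z\<bar> + \<bar>T $$ z\<bar>)"
  have B0: "B \<ge> 0" by (simp add: B_def sum_nonneg)
  have B: "\<bar>(E * transpose_mat E) $$ (i, j)\<bar> \<le> B" "\<bar>T $$ (i, j)\<bar> \<le> B" if "i < n" "j < n" for i j
    using member_le_sum[of "(i, j)" ?I "\<lambda>z. \<bar>(E * transpose_mat E) $$ z\<bar> + \<bar>T $$ z\<bar>"] that
    unfolding B_def[symmetric] by (auto simp del: index_mult_mat)
  \<comment> \<open>\<open>\<epsilon> \<le> 1\<close> gives
    \<open>\<epsilon>\<^sup>2 \<le> \<epsilon>\<close>, so one bound \<open>\<epsilon> * B\<close>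
    covers both \<open>EE\<close> and the scaled \<open>T\<close>; the other bound keeps the first
    iterate within \<open>\<rho> / 2\<close>.\<close>
  define \<epsilon> where "\<epsilon> = min 1 (\<rho> / (2 * (C * B + 1)))"
  have CB: "C * B \<ge> 0" using C B0 by simp
  have \<epsilon>0: "\<epsilon> > 0" and \<epsilon>1: "\<epsilon> \<le> 1" using \<rho>0 CB by (simp_all add: \<epsilon>_def)
  have "\<epsilon> * (C * B + 1) \<le> (\<rho> / (2 * (C * B + 1))) * (C * B + 1)"
    using CB by (intro mult_right_mono) (auto simp: \<epsilon>_def)
  also have "\<dots> = \<rho> / 2" using CB by (simp add: field_simps)
  finally have \<epsilon>C: "C * (\<epsilon> * B) \<le> \<rho> / 2" using \<epsilon>0 by (simp add: algebra_simps)
  define E' where "E' = \<epsilon> \<cdot>\<^sub>m E"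
  define EE where "EE = E' * transpose_mat E'"
  have E'c: "E' \<in> carrier_mat n p" using E by (simp add: E'_def)
  have EEc: "EE \<in> carrier_mat n n" using E'c by (simp add: EE_def)
  have EEsym: "transpose_mat EE = EE"
    using transpose_mult[OF E'c, of "transpose_mat E'" n] E'c by (simp add: EE_def)
  have EEB: "\<bar>EE $$ (i, j)\<bar> \<le> \<epsilon> * B" if ij: "i < n" "j < n" for i j
  proof -
    have "EE $$ (i, j) = \<epsilon>\<^sup>2 * (E * transpose_mat E) $$ (i, j)"
      using ij E by (simp add: EE_def E'_def scalar_prod_def sum_distrib_left power2_eq_square mult_ac)
    then have "\<bar>EE $$ (i, j)\<bar> = \<epsilon>\<^sup>2 * \<bar>(E * transpose_mat E) $$ (i, j)\<bar>"
      by (simp add: abs_mult del: index_mult_mat)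
    also have "\<dots> \<le> \<epsilon> * B"
      using \<epsilon>0 \<epsilon>1 by (intro mult_mono B ij) (auto simp: power2_eq_square mult_left_le)
    finally show ?thesis .
  qed
  define W where "W H = - (H * transpose_mat H + EE)" for H
  have Wc: "W H \<in> carrier_mat n n" if "H \<in> carrier_mat n n" for H
    using that EEc by (simp add: W_def)
  have Wsym: "transpose_mat (W H) = W H" if H: "H \<in> carrier_mat n n" for H
  proof -
    have "transpose_mat (H * transpose_mat H) = H * transpose_mat H"
      using transpose_mult[OF H, of "transpose_mat H" n] H by simp
    then have "transpose_mat (H * transpose_mat H + EE) = H * transpose_mat H + EE"
      using transpose_add[of "H * transpose_mat H" n n EE] H EEc EEsym by simp
    then show ?thesis unfolding W_def by (metis transpose_uminus)
  qed
  \<comment> \<open>\<open>T\<close> carries no dimensions, so an \<open>n\<close> by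
    \<open>n\<close> matrix is formed from its entries before scaling.\<close>
  define F where "F h z = R (W (mat n n h)) (\<epsilon> \<cdot>\<^sub>m mat n n (\<lambda>z. T $$ z)) $$ z" for h :: "nat \<times> nat \<Rightarrow> real" and z
  have "\<exists>h. (\<forall>z\<in>?I. \<bar>h z\<bar> \<le> \<rho>) \<and> (\<forall>z\<in>?I. F h z = h z)"
  proof (rule contraction_fixed_point)
    show "\<rho> \<ge> 0" using \<rho>0 by simp
  next
    fix z assume "z \<in> ?I"
    then obtain i j where z: "z = (i, j)" and ij: "i < n" "j < n" by auto
    have W0: "W (mat n n (\<lambda>_. 0)) = - EE"
    proof -
      have "mat n n (\<lambda>_. 0) = (0\<^sub>m n n :: real mat)" by (intro eq_matI) auto
      then show ?thesis using EEc by (simp add: W_def)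
    qed
    \<comment> \<open>Since \<open>R\<close> vanishes at zero data, its Lipschitz bound there
      estimates the first iterate itself.\<close>
    have "\<bar>F (\<lambda>_. 0) (i, j) - R (0\<^sub>m n n) (0\<^sub>m n n) $$ (i, j)\<bar> \<le> C * (\<epsilon> * B)"
      unfolding F_def W0
      by (rule lip) (use EEc ij EEB B \<epsilon>0 in \<open>auto simp: abs_mult\<close>)
    then show "\<bar>F (\<lambda>_. 0) z\<bar> \<le> \<rho> / 2" using \<epsilon>C ij by (simp add: z R0)
  next
    fix x y :: "nat \<times> nat \<Rightarrow> real" and d z
    assume x: "\<forall>z\<in>?I. \<bar>x z\<bar> \<le> \<rho>" and y: "\<forall>z\<in>?I. \<bar>y z\<bar> \<le> \<rho>"
      and xy: "\<forall>z\<in>?I. \<bar>x z - y z\<bar> \<le> d" and "z \<in> ?I"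
    then obtain i j where z: "z = (i, j)" and ij: "i < n" "j < n" by auto
    have "\<bar>x (i, j) - y (i, j)\<bar> \<le> d" using xy ij by simp
    then have d: "d \<ge> 0" by linarith
    have "\<bar>F x (i, j) - F y (i, j)\<bar> \<le> C * (real n * (2 * \<rho> * d))"
      unfolding F_def
    proof (rule lip[OF Wc Wc _ _ ij])
      fix i j assume ij: "i < n" "j < n"
      let ?x = "mat n n x" and ?y = "mat n n y"
      have "W ?x $$ (i, j) - W ?y $$ (i, j)
          = - ((?x * transpose_mat ?x) $$ (i, j) - (?y * transpose_mat ?y) $$ (i, j))"
        using ij EEc by (simp add: W_def del: index_mult_mat(1))
      also have "\<bar>\<dots>\<bar> \<le> real n * (2 * \<rho> * d)"
        unfolding abs_minus
        by (rule gram_entry_diff_le[of _ n n]) (use x y xy ij in auto)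
      finally show "\<bar>W ?x $$ (i, j) - W ?y $$ (i, j)\<bar> \<le> real n * (2 * \<rho> * d)" .
    qed (use \<rho>0 d in auto)
    also have "\<dots> = (4 * (C * n) * \<rho>) * (d / 2)" by simp
    also have "\<dots> \<le> 1 * (d / 2)" using d by (intro mult_right_mono \<rho>C) simp
    finally show "\<bar>F x z - F y z\<bar> \<le> d / 2" by (simp add: z)
  qed
  then obtain h where hI: "\<forall>z\<in>?I. \<bar>h z\<bar> \<le> \<rho>" "\<forall>z\<in>?I. F h z = h z" by blast
  then have h: "\<bar>h (i, j)\<bar> \<le> \<rho>" and Fh: "F h (i, j) = h (i, j)" if "i < n" "j < n" for i j
    using that by auto
  define H where "H = mat n n h"
  let ?T' = "\<epsilon> \<cdot>\<^sub>m mat n n (\<lambda>z. T $$ z)"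
  have H: "H \<in> carrier_mat n n" by (simp add: H_def)
  have HR: "R (W H) ?T' = H"
    by (rule eq_matI) (use Rc[OF Wc[OF H], of ?T'] Fh in \<open>auto simp: F_def H_def\<close>)
  have QH: "Q * transpose_mat H + H * transpose_mat Q = W H"
    using lin[OF Wc[OF H] Wsym[OF H], of ?T'] unfolding HR .
  let ?M = "Q + H"
  have M: "?M \<in> carrier_mat n n" using Q H by simp
  have Hs: "transpose_mat H \<in> carrier_mat n n" "transpose_mat Q \<in> carrier_mat n n" using H Q by auto
  have gram: "?M * transpose_mat ?M + EE = c \<cdot>\<^sub>m 1\<^sub>m n"
  proof (rule eq_matI)
    fix i j assume "i < dim_row (c \<cdot>\<^sub>m 1\<^sub>m n)" "j < dim_col (c \<cdot>\<^sub>m 1\<^sub>m n)"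
    then have ij: "i < n" "j < n" by auto
    have MM: "?M * transpose_mat ?M = (Q * transpose_mat Q + H * transpose_mat Q)
        + (Q * transpose_mat H + H * transpose_mat H)"
      using Q H Hs by (simp add: transpose_add[of _ n n] mult_add_distrib_mat[of _ n n]
        add_mult_distrib_mat[of _ n n])
    have "(Q * transpose_mat H) $$ (i, j) + (H * transpose_mat Q) $$ (i, j) = W H $$ (i, j)"
      unfolding QH[symmetric] using Q H ij by (simp del: index_mult_mat(1))
    moreover have "W H $$ (i, j) = - ((H * transpose_mat H) $$ (i, j) + EE $$ (i, j))"
      using H EEc ij by (simp add: W_def del: index_mult_mat(1))
    moreover have "(?M * transpose_mat ?M + EE) $$ (i, j)
        = (Q * transpose_mat Q) $$ (i, j) + (H * transpose_mat Q) $$ (i, j)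
          + ((Q * transpose_mat H) $$ (i, j) + (H * transpose_mat H) $$ (i, j)) + EE $$ (i, j)"
      unfolding MM using Q H EEc ij by (simp del: index_mult_mat(1))
    ultimately show "(?M * transpose_mat ?M + EE) $$ (i, j) = (c \<cdot>\<^sub>m 1\<^sub>m n) $$ (i, j)"
      unfolding QQ by linarith
  qed (use EEc in auto)
  have "if Q $$ (i, j) = 0 then ?M $$ (i, j) = \<epsilon> * T $$ (i, j) else ?M $$ (i, j) \<noteq> 0"
    if ij: "i < n" "j < n" for i j
  proof -
    have Mij: "?M $$ (i, j) = Q $$ (i, j) + h (i, j)" using Q ij by (simp add: H_def)
    show ?thesis
    proof (cases "Q $$ (i, j) = 0")
      case True
      then have "h (i, j) = \<epsilon> * T $$ (i, j)"
        using onZ[OF Wc[OF H] ij True, of ?T'] ij unfolding HR by (simp add: H_def)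
      then show ?thesis using True Mij by simp
    next
      case False
      have "\<rho> < \<mu>" using \<mu>0 by (simp add: \<rho>_def)
      then have "\<bar>h (i, j)\<bar> < \<bar>Q $$ (i, j)\<bar>" using h[OF ij] \<mu>[OF ij False] by linarith
      then show ?thesis using False Mij by auto
    qed
  qed
  then show ?thesis using \<epsilon>0 M gram unfolding EE_def E'_def by blast
qed

section \<open>Assembling the matrix with pattern \<open>S\<close>\<close>

theorem theorem4p5:
  fixes n k p :: nat and Q :: "real mat" and S :: "nat mat" and l :: real
  assumes "Q \<in> carrier_mat n n"
    and "SSVP Q"
    and "rows_mutually_orthogonal Q"
    and "rows_of_length Q l"
    and "k < n"
    and "k \<le> p"
    and "is_superpattern S
           (four_block_mat (zero_nonzero_pattern Q) (0\<^sub>m n p)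
                           (0\<^sub>m k n)                (0\<^sub>m k p))"
  shows "\<exists>A :: real mat. A \<in> carrier_mat (n + k) (n + p) \<and> has_pattern A S \<and>
           sv_multiplicity A l \<ge> n - k"
proof -
  note Q = assms(1)
  let ?R = "four_block_mat (zero_nonzero_pattern Q) (0\<^sub>m n p) (0\<^sub>m k n) (0\<^sub>m k p)"
  have l: "l > 0" using SSVP_imp_row_length_pos[OF Q _ assms(2,4)] assms(5) by simp
  have QQ: "Q * transpose_mat Q = l\<^sup>2 \<cdot>\<^sub>m 1\<^sub>m n"
    by (rule gram_of_orthogonal_rows[OF Q assms(3,4)])
  have S: "S \<in> carrier_mat (n + k) (n + p)" and pat: "is_pattern S"
    and sup: "\<And>i j. i < n + k \<Longrightarrow> j < n + p \<Longrightarrow> ?R $$ (i, j) = 1 \<Longrightarrow> S $$ (i, j) = 1"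
    using assms(7) Q by (auto simp: is_superpattern_def zero_nonzero_pattern_def)
  have S01: "S $$ (i, j) = 0 \<or> S $$ (i, j) = 1" if "i < n + k" "j < n + p" for i j
    using pat elements_matI[OF S that refl] by (auto simp: is_pattern_def)
  have supQ: "S $$ (i, j) = 1" if "i < n" "j < n" "Q $$ (i, j) \<noteq> 0" for i j
    using that Q by (intro sup) (auto simp: zero_nonzero_pattern_def)
  \<comment> \<open>The blocks of \<open>S\<close> outside the leading one serve as real blocks with
    the right zeros; \<open>E\<close> is still to be scaled by \<open>\<epsilon>\<close>, which
    preserves its pattern.\<close>
  define E where "E = mat n p (\<lambda>(i, j). real (S $$ (i, j + n)))"
  define L where "L = mat k n (\<lambda>(i, j). real (S $$ (i + n, j)))"
  define D where "D = mat k p (\<lambda>(i, j). real (S $$ (i + n, j + n)))"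
  have c: "E \<in> carrier_mat n p" "L \<in> carrier_mat k n" "D \<in> carrier_mat k p"
    by (simp_all add: E_def L_def D_def)
  obtain \<epsilon> M where \<epsilon>: "\<epsilon> > 0" and M: "M \<in> carrier_mat n n"
    and gram: "M * transpose_mat M + (\<epsilon> \<cdot>\<^sub>m E) * transpose_mat (\<epsilon> \<cdot>\<^sub>m E) = l\<^sup>2 \<cdot>\<^sub>m 1\<^sub>m n"
    and MS: "\<And>i j. i < n \<Longrightarrow> j < n \<Longrightarrow>
      if Q $$ (i, j) = 0 then M $$ (i, j) = \<epsilon> * map_mat real S $$ (i, j) else M $$ (i, j) \<noteq> 0"
    using perturb_to_orthogonal_rows[OF Q QQ _ assms(2) c(1), of "map_mat real S"] l by auto
  define A where "A = four_block_mat M (\<epsilon> \<cdot>\<^sub>m E) L D"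
  have A: "A \<in> carrier_mat (n + k) (n + p)" using M c by (simp add: A_def)
  \<comment> \<open>At nonzero entries of \<open>Q\<close> both sides hold, because \<open>S\<close>
    is a superpattern; at its zeros \<open>M\<close> equals \<open>\<epsilon>\<close> times
    \<open>S\<close>, which vanishes exactly where \<open>S\<close> does.\<close>
  have MS': "M $$ (i, j) \<noteq> 0 \<longleftrightarrow> S $$ (i, j) = 1" if ij: "i < n" "j < n" for i j
    using MS[OF ij] supQ[OF ij] S01[of i j] ij S \<epsilon> by (auto split: if_splits)
  have "A $$ (i, j) \<noteq> 0 \<longleftrightarrow> S $$ (i, j) = 1" if ij: "i < n + k" "j < n + p" for i j
    using S01[OF ij] MS'[of i j] ij M c \<epsilon>
    by (auto simp: A_def E_def L_def D_def)
  then have "has_pattern A S" using A S pat by (simp add: has_pattern_def)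
  moreover have "n - k \<le> sv_multiplicity A l"
  proof (rule sv_multiplicity_ge_scalar_block[OF A])
    fix i j assume ij: "i < n" "j < n"
    let ?E = "\<epsilon> \<cdot>\<^sub>m E"
    have E: "?E \<in> carrier_mat n p" using c by simp
    have At: "transpose_mat A = four_block_mat (transpose_mat M) (transpose_mat L)
        (transpose_mat ?E) (transpose_mat D)"
      unfolding A_def by (rule transpose_four_block_mat[OF M E c(2,3)])
    \<comment> \<open>Only the upper left block of the product is read off; it is the Gram matrix of
      the first \<open>n\<close> rows.\<close>
    have "A * transpose_mat A = four_block_mat (l\<^sup>2 \<cdot>\<^sub>m 1\<^sub>m n) (M * transpose_mat L + ?E * transpose_mat D)
        (L * transpose_mat M + D * transpose_mat ?E) (L * transpose_mat L + D * transpose_mat D)"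
      unfolding At gram[symmetric] unfolding A_def
      by (rule mult_four_block_mat[OF M E c(2,3)]) (use M c in auto)
    then show "(A * transpose_mat A) $$ (i, j) = (if i = j then l\<^sup>2 else 0)"
      using ij by (simp del: index_mult_mat(1))
  qed (use l in simp)
  ultimately show ?thesis using A by blast
qed

end
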